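(* Let $G$ be a connected graph of order $n\geq 5$, size $m$ (number of edges), minimum degree $\delta$ and vertex-connectivity $\kappa$. If $m \geq \binom{n-2}{2}+2\delta$, then $G$ is super-$\kappa$, unless $G\cong (K_{\delta}\vee (K_2\cup K_{n-\delta-2}))-e$, where $e=xy$ is an edge of $K_{\delta}\vee (K_2\cup K_{n-\delta-2})$ such that, in $K_{\delta}\vee (K_2\cup K_{n-\delta-2})$, $x$ has degree $\delta+1$ and $y$ has degree $n-1$.
   Context: All graphs are finite, simple and undirected. A vertex-cut of a connected graph is a set of vertices whose removal disconnects it; the vertex-connectivity $\kappa(G)$ of a connected non-complete graph is the minimum size of a vertex-cut, and $\kappa(K_n)=n-1$; a minimum vertex-cut is a vertex-cut of size $\kappa(G)$. $G$ is super-connected (super-$\kappa$) if every minimum vertex-cut isolates a vertex of minimum degree (i.e., for every minimum vertex-cut $S$, some component of $G-S$ is a single vertex of degree $\delta(G)$). $K_r$ is the complete graph on $r$ vertices, $\cup$ is disjoint union, $G_1\vee G_2$ is the join (disjoint union plus all edges between $G_1$ and $G_2$), and $H-e$ denotes deletion of edge $e$. *)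

theory Defs
  imports "Graph_Theory.Graph_Theory"
begin

text \<open>
  A finite simple undirected graph is a \<open>pair_graph\<close>: a finite loop-free digraph whose arcs are
  ordered pairs and whose arc relation is symmetric.  Each undirected edge \<open>uv\<close> is thus present as
  the two arcs \<open>(u,v)\<close> and \<open>(v,u)\<close>.  Consequently the degree of a vertex is its out-degree, and the
  connected components are the strongly connected components.
\<close>

definition edge_set :: "'a pair_pre_digraph \<Rightarrow> 'a set set" where
  "edge_set G = {{u, v} | u v. (u, v) \<in> parcs G}"

definition min_degree :: "'a pair_pre_digraph \<Rightarrow> nat" where
  "min_degree G = Min (out_degree (with_proj G) ` pverts G)"

definition delete_verts :: "'a pair_pre_digraph \<Rightarrow> 'a set \<Rightarrow> ('a, 'a \<times> 'a) pre_digraph" where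
  "delete_verts G S = with_proj G \<restriction> (pverts G - S)"

text \<open>
  The library's \<open>connected\<close> is false for the graph without vertices, so removing all vertices has
  to be excluded explicitly.
\<close>

definition vertex_cut :: "'a pair_pre_digraph \<Rightarrow> 'a set \<Rightarrow> bool" where
  "vertex_cut G S \<longleftrightarrow>
     S \<subseteq> pverts G \<and> pverts G - S \<noteq> {} \<and> \<not> connected (delete_verts G S)"

text \<open>Meant for connected graphs; a connected non-complete graph always has a vertex-cut.\<close>

definition vertex_connectivity :: "'a pair_pre_digraph \<Rightarrow> nat" where
  "vertex_connectivity G =
     (if K\<^bsub>card (pverts G)\<^esub> (with_proj G) then card (pverts G) - 1
      else (LEAST k. \<exists>S. vertex_cut G S \<and> card S = k))"

definition min_vertex_cut :: "'a pair_pre_digraph \<Rightarrow> 'a set \<Rightarrow> bool" where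
  "min_vertex_cut G S \<longleftrightarrow> vertex_cut G S \<and> card S = vertex_connectivity G"

text \<open>
  The degree of the isolated vertex is taken in \<open>G\<close>, not in \<open>G - S\<close>.  A complete graph has no
  vertex-cut and is therefore super-connected.
\<close>

definition super_connected :: "'a pair_pre_digraph \<Rightarrow> bool" where
  "super_connected G \<longleftrightarrow>
     (\<forall>S. min_vertex_cut G S \<longrightarrow>
        (\<exists>v. {v} \<in> pre_digraph.sccs_verts (delete_verts G S) \<and>
             out_degree (with_proj G) v = min_degree G))"

definition complete_graph :: "nat \<Rightarrow> nat pair_pre_digraph" where
  "complete_graph r =
     \<lparr> pverts = {..<r}, parcs = {(u, v). u < r \<and> v < r \<and> u \<noteq> v} \<rparr>"

definition disjoint_union ::
    "'a pair_pre_digraph \<Rightarrow> 'b pair_pre_digraph \<Rightarrow> ('a + 'b) pair_pre_digraph" where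
  "disjoint_union G H =
     \<lparr> pverts = Inl ` pverts G \<union> Inr ` pverts H,
       parcs = map_prod Inl Inl ` parcs G \<union> map_prod Inr Inr ` parcs H \<rparr>"

definition graph_join ::
    "'a pair_pre_digraph \<Rightarrow> 'b pair_pre_digraph \<Rightarrow> ('a + 'b) pair_pre_digraph" where
  "graph_join G H =
     \<lparr> pverts = pverts (disjoint_union G H),
       parcs = parcs (disjoint_union G H) \<union>
         (Inl ` pverts G) \<times> (Inr ` pverts H) \<union> (Inr ` pverts H) \<times> (Inl ` pverts G) \<rparr>"

definition delete_edge :: "'a pair_pre_digraph \<Rightarrow> 'a \<Rightarrow> 'a \<Rightarrow> 'a pair_pre_digraph" where
  "delete_edge G x y = \<lparr> pverts = pverts G, parcs = parcs G - {(x, y), (y, x)} \<rparr>"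

lemma complete_graph_is_complete: "K\<^bsub>r\<^esub> (with_proj (complete_graph r))"
  by (auto simp: complete_digraph_pair_def complete_graph_def)

end

theory Submission
  imports Defs
begin

text \<open>
  Let \<open>S\<close> be a minimum vertex-cut that isolates no vertex of minimum degree, so \<open>card S \<le> \<delta>\<close>.
  An isolated vertex of \<open>G - S\<close> would have degree at most \<open>card S\<close>, hence \<open>\<delta>\<close>; so \<open>G - S\<close> splits
  into parts \<open>A\<close>, \<open>B\<close> without isolated vertices.  If \<open>A\<close>, \<open>B\<close> have sizes \<open>i + 2\<close>, \<open>j + 2\<close> and \<open>r\<close> non-edges
  are not between \<open>A\<close> and \<open>B\<close>, then counting all non-edges turns the hypothesis on \<open>m\<close> into
  \<open>i j + r + 2 \<delta> \<le> 1 + 2 card S\<close>, whence \<open>card S = \<delta>\<close> and \<open>r \<le> 1\<close>.  A vertex of minimum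
  degree now has at most one non-neighbour within its own part and \<open>S\<close>.  Therefore it lies in a part
  of size two, say \<open>A\<close>, and its only such non-neighbour lies in \<open>S\<close>, which determines \<open>G\<close>.
\<close>

section \<open>Degrees, reachability and separations\<close>

lemma out_degree_with_proj: "out_degree (with_proj G) v = card {u. (v, u) \<in> parcs G}"
proof -
  have "out_arcs (with_proj G) v = Pair v ` {u. (v, u) \<in> parcs G}"
    by (auto simp: out_arcs_def)
  then show ?thesis by (simp add: out_degree_def card_image inj_on_def)
qed

lemma reachable_closed:
  assumes "u \<rightarrow>\<^sup>*\<^bsub>D\<^esub> v" and "u \<in> A"
    and closed: "\<And>a b. (a, b) \<in> arcs_ends D \<Longrightarrow> a \<in> A \<Longrightarrow> b \<in> A"
  shows "v \<in> A"
  using assms(1,2) unfolding reachable_def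
  by (induction rule: rtrancl_on_induct) (auto intro: closed)

lemma arcs_ends_delete_verts:
  "arcs_ends (delete_verts G S) =
     {(u, v) \<in> parcs G. u \<in> pverts G - S \<and> v \<in> pverts G - S}"
  by (auto simp: arcs_ends_def arc_to_ends_def delete_verts_def)

lemma verts_delete_verts: "verts (delete_verts G S) = pverts G - S"
  by (simp add: delete_verts_def)

context pair_graph
begin

text \<open>The library's connectedness refers to the symmetric closure of the arc relation. Here
  that relation is already symmetric, so plain reachability decides it.\<close>

lemma connected_delete_verts_iff:
  "connected (delete_verts G S) \<longleftrightarrow> pverts G - S \<noteq> {} \<and>
     (\<forall>u \<in> pverts G - S. \<forall>v \<in> pverts G - S. u \<rightarrow>\<^sup>*\<^bsub>delete_verts G S\<^esub> v)"
proof -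
  interpret D: wf_digraph "delete_verts G S"
    by (auto simp: wf_digraph_def delete_verts_def)
  have "symmetric (delete_verts G S)"
    using arcs_symmetric by (auto simp: symmetric_conv delete_verts_def)
  then show ?thesis
    by (simp add: connected_def strongly_connected_def D.reachable_mk_symmetric_eq verts_delete_verts)
qed

text \<open>If \<open>v\<close> is not reachable from \<open>u\<close>, the vertices reachable from
  \<open>u\<close> and the remaining ones form the two sides. Conversely, \<open>A\<close> is closed
  under the arcs of \<open>G - S\<close>, so no walk leads from it into \<open>B\<close>. The sides
  need not be connected.\<close>

lemma vertex_cut_iff_separation:
  "vertex_cut G S \<longleftrightarrow> S \<subseteq> pverts G \<and> (\<exists>A B. A \<noteq> {} \<and> B \<noteq> {} \<and> A \<inter> B = {} \<and>
     A \<union> B = pverts G - S \<and> (\<forall>a \<in> A. \<forall>b \<in> B. (a, b) \<notin> parcs G))"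
    (is "_ \<longleftrightarrow> _ \<and> ?sep")
proof (intro iffI conjI)
  assume cut: "vertex_cut G S"
  then show "S \<subseteq> pverts G" by (simp add: vertex_cut_def)
  let ?D = "delete_verts G S"
  obtain u v where uv: "u \<in> pverts G - S" "v \<in> pverts G - S" "\<not> u \<rightarrow>\<^sup>*\<^bsub>?D\<^esub> v"
    using cut unfolding vertex_cut_def connected_delete_verts_iff by blast
  interpret D: wf_digraph ?D by (auto simp: wf_digraph_def delete_verts_def)
  let ?A = "{w \<in> pverts G - S. u \<rightarrow>\<^sup>*\<^bsub>?D\<^esub> w}"
  let ?B = "{w \<in> pverts G - S. \<not> u \<rightarrow>\<^sup>*\<^bsub>?D\<^esub> w}"
  have "u \<in> ?A" using uv(1) by (simp add: D.reachable_refl verts_delete_verts)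
  moreover have "v \<in> ?B" using uv by simp
  moreover have "(a, b) \<notin> parcs G" if "a \<in> ?A" "b \<in> ?B" for a b
  proof
    assume "(a, b) \<in> parcs G"
    then have "(a, b) \<in> arcs_ends ?D" using that by (simp add: arcs_ends_delete_verts)
    then have "u \<rightarrow>\<^sup>*\<^bsub>?D\<^esub> b" using that(1) by (blast intro: D.reachable_adj_trans)
    then show False using that(2) by simp
  qed
  moreover have "?A \<inter> ?B = {}" "?A \<union> ?B = pverts G - S" by blast+
  ultimately show ?sep by (metis (no_types, lifting) empty_iff)
next
  assume "S \<subseteq> pverts G \<and> ?sep"
  then obtain A B where S: "S \<subseteq> pverts G" and AB: "A \<noteq> {}" "B \<noteq> {}" "A \<inter> B = {}"
      "A \<union> B = pverts G - S" "\<forall>a \<in> A. \<forall>b \<in> B. (a, b) \<notin> parcs G"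
    by (elim conjE exE) (rule that)
  obtain a b where ab: "a \<in> A" "b \<in> B" using AB(1,2) by blast
  have "\<not> a \<rightarrow>\<^sup>*\<^bsub>delete_verts G S\<^esub> b"
  proof
    assume "a \<rightarrow>\<^sup>*\<^bsub>delete_verts G S\<^esub> b"
    then have "b \<in> A"
      by (rule reachable_closed) (use ab AB in \<open>auto simp: arcs_ends_delete_verts\<close>)
    then show False using ab AB(3) by blast
  qed
  then show "vertex_cut G S"
    unfolding vertex_cut_def connected_delete_verts_iff using S ab AB(4) by (metis UnI1 UnI2 empty_iff)
qed

lemma isolated_in_sccs_verts:
  assumes v: "v \<in> pverts G - S" and nb: "\<And>u. (v, u) \<in> parcs G \<Longrightarrow> u \<in> S"
  shows "{v} \<in> pre_digraph.sccs_verts (delete_verts G S)"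
proof -
  interpret D: wf_digraph "delete_verts G S"
    by (auto simp: wf_digraph_def delete_verts_def)
  have "w = v" if "v \<rightarrow>\<^sup>*\<^bsub>delete_verts G S\<^esub> w" for w
    using reachable_closed[OF that, of "{v}"] nb by (auto simp: arcs_ends_delete_verts)
  then show ?thesis
    using v by (auto simp: D.sccs_verts_def D.reachable_refl verts_delete_verts)
qed

section \<open>Minimum degree and vertex-connectivity\<close>

lemma finite_neighbours: "finite {u. (v, u) \<in> parcs G}"
  by (rule finite_subset[OF _ pair_finite_verts]) (auto dest: in_arcsD2)

lemma min_degree_le: "v \<in> pverts G \<Longrightarrow> min_degree G \<le> card {u. (v, u) \<in> parcs G}"
  by (simp add: min_degree_def out_degree_with_proj pair_finite_verts)

lemma min_degree_witness:
  assumes "pverts G \<noteq> {}"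
  obtains v where "v \<in> pverts G" "card {u. (v, u) \<in> parcs G} = min_degree G"
proof -
  have "min_degree G \<in> out_degree (with_proj G) ` pverts G"
    unfolding min_degree_def using assms pair_finite_verts by (intro Min_in) auto
  then show ?thesis using that by (auto simp: out_degree_with_proj)
qed

text \<open>The neighbourhood of a vertex \<open>v\<close> of minimum degree cuts \<open>v\<close>
  off from its non-neighbours. If there are none, every degree is
  \<open>card (pverts G) - 1\<close>; then \<open>G\<close> is complete and its connectivity has
  that value by definition.\<close>

lemma vertex_connectivity_le_min_degree:
  assumes "pverts G \<noteq> {}"
  shows "vertex_connectivity G \<le> min_degree G"
proof -
  obtain v where v: "v \<in> pverts G" "card {u. (v, u) \<in> parcs G} = min_degree G"
    using min_degree_witness[OF assms] by blast
  have sub: "{u. (x, u) \<in> parcs G} \<subseteq> pverts G - {x}" for x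
    by (auto dest: in_arcsD2 no_loops')
  show ?thesis
  proof (cases "{u. (v, u) \<in> parcs G} = pverts G - {v}")
    case True
    then have deg: "min_degree G = card (pverts G) - 1"
      using v pair_finite_verts by simp
    have "{u. (x, u) \<in> parcs G} = pverts G - {x}" if "x \<in> pverts G" for x
      using min_degree_le[OF that] that deg sub[of x] pair_finite_verts
      by (intro card_seteq) auto
    then have "parcs G = {(u, v). (u, v) \<in> pverts G \<times> pverts G \<and> u \<noteq> v}"
      using in_arcsD1 by blast
    then have "K\<^bsub>card (pverts G)\<^esub> (with_proj G)"
      by (simp add: complete_digraph_pair_def pair_finite_verts)
    then show ?thesis by (simp add: vertex_connectivity_def deg)
  next
    case False
    let ?N = "{u. (v, u) \<in> parcs G}"
    have "vertex_cut G ?N"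
      unfolding vertex_cut_iff_separation
      using sub[of v] False v(1)
      by (intro conjI exI[of _ "{v}"] exI[of _ "pverts G - {v} - ?N"]) auto
    moreover have "\<not> K\<^bsub>card (pverts G)\<^esub> (with_proj G)"
      using sub[of v] False v(1) by (auto simp: complete_digraph_pair_def)
    ultimately show ?thesis
      using v(2) by (auto simp: vertex_connectivity_def intro!: Least_le)
  qed
qed

section \<open>Non-edges\<close>

text \<open>Two-element sets count each undirected non-edge once, in line with
  \<open>edge_set\<close>; arcs would count it twice.\<close>

definition missing_edges :: "'a set set" where
  "missing_edges = {X. X \<subseteq> pverts G \<and> card X = 2} - edge_set G"

lemma finite_missing_edges: "finite missing_edges"
  unfolding missing_edges_def using pair_finite_verts by simp

lemma card_edge_set_plus_missing:
  "card (edge_set G) + card missing_edges = card (pverts G) choose 2"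
proof -
  let ?P = "{X. X \<subseteq> pverts G \<and> card X = 2}"
  have sub: "edge_set G \<subseteq> ?P"
    by (auto simp: edge_set_def card_2_iff dest: in_arcsD1 in_arcsD2 no_loops')
  have "finite ?P" using pair_finite_verts by simp
  then have "card (edge_set G) + card missing_edges = card ?P"
    unfolding missing_edges_def using sub
    by (simp add: card_Diff_subset card_mono finite_subset)
  then show ?thesis by (simp add: n_subsets pair_finite_verts)
qed

lemma in_missing_edges_iff:
  assumes "p \<in> pverts G" "q \<in> pverts G" "p \<noteq> q"
  shows "{p, q} \<in> missing_edges \<longleftrightarrow> (p, q) \<notin> parcs G"
  using assms arcs_symmetric by (auto simp: missing_edges_def edge_set_def doubleton_eq_iff)

end

section \<open>Counting the non-edges of a separated graph\<close>

lemma two_le_card_if_partner: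
  assumes "finite A" "A \<noteq> {}" and "\<And>a. a \<in> A \<Longrightarrow> \<exists>u \<in> A. u \<noteq> a"
  shows "2 \<le> card A"
proof -
  obtain a u where "a \<in> A" "u \<in> A" "u \<noteq> a" using assms(2,3) by blast
  then have "card {a, u} \<le> card A" using assms(1) by (intro card_mono) auto
  then show ?thesis using \<open>u \<noteq> a\<close> by simp
qed

text \<open>Here \<open>a\<close>, \<open>b\<close>, \<open>k\<close> are the sizes of the two sides
  and of the cut, and \<open>r\<close> counts the non-edges not between the sides.\<close>

lemma separation_arithmetic:
  fixes a b k d m r n :: nat
  assumes "2 \<le> a" "2 \<le> b" "k \<le> d" "n = a + b + k"
    and "((n - 2) choose 2) + 2 * d \<le> m" "m + (a * b + r) = n choose 2"
  shows "k = d" "r \<le> 1"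
proof -
  obtain i j where ij: "a = i + 2" "b = j + 2"
    using assms(1,2) by (metis add.commute le_Suc_ex)
  define t where "t = n - 2"
  have "n = Suc (Suc t)" using assms(1,4) by (simp add: t_def)
  \<comment> \<open>Pascal's rule, applied twice, compares \<open>n choose 2\<close> with the term
    \<open>(n - 2) choose 2\<close> of the edge bound.\<close>
  then have "n choose 2 = (t choose 2) + 2 * t + 1" by (simp add: numeral_2_eq_2)
  moreover have "t = i + j + k + 2" using assms(4) ij by (simp add: t_def)
  ultimately have "i * j + r + 2 * d \<le> 1 + 2 * k"
    using assms(5,6) by (simp add: ij t_def[symmetric] algebra_simps)
  \<comment> \<open>Integrality matters: \<open>2 * d \<le> 1 + 2 * k\<close> already forces
    \<open>d \<le> k\<close>.\<close>
  then show "k = d" "r \<le> 1" using assms(3) by linarith+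
qed

text \<open>This is the situation left by a minimum cut \<open>S\<close> violating
  super-connectedness. \<open>neighbour_outside\<close> says that \<open>G - S\<close> has no
  isolated vertex. All assumptions are symmetric in \<open>A\<close> and \<open>B\<close>.\<close>

locale separated_graph = pair_graph +
  fixes A B S :: "'a set"
  assumes partition: "A \<union> B \<union> S = pverts G" "A \<inter> B = {}" "A \<inter> S = {}" "B \<inter> S = {}"
    and nonempty: "A \<noteq> {}" "B \<noteq> {}"
    and no_cross_arcs: "\<And>a b. a \<in> A \<Longrightarrow> b \<in> B \<Longrightarrow> (a, b) \<notin> parcs G"
    and neighbour_outside: "\<And>v. v \<in> A \<union> B \<Longrightarrow> \<exists>u. (v, u) \<in> parcs G \<and> u \<notin> S"
    and card_S_le: "card S \<le> min_degree G"
    and edges_ge: "((card (pverts G) - 2) choose 2) + 2 * min_degree G \<le> card (edge_set G)"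
begin

text \<open>Together with this reversed form, the assumptions of the locale can be restated with the
  two sides exchanged.\<close>

lemma no_cross_arcs': "a \<in> A \<Longrightarrow> b \<in> B \<Longrightarrow> (b, a) \<notin> parcs G"
  using no_cross_arcs[of a b] arcs_symmetric[of b a] by blast

lemma separated_graph_swap: "separated_graph G B A S"
proof unfold_locales
  show "\<exists>u. (v, u) \<in> parcs G \<and> u \<notin> S" if "v \<in> B \<union> A" for v
    using neighbour_outside that by (simp add: Un_commute)
qed (use partition nonempty no_cross_arcs' card_S_le edges_ge in \<open>simp_all add: ac_simps\<close>)

lemma neighbour_in_A:
  assumes "a \<in> A" shows "\<exists>u \<in> A. u \<noteq> a \<and> (a, u) \<in> parcs G"
proof -
  obtain u where u: "(a, u) \<in> parcs G" "u \<notin> S" using neighbour_outside assms by blast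
  then have "u \<in> A" using in_arcsD2[OF u(1)] partition(1) no_cross_arcs[OF assms] by blast
  then show ?thesis using u(1) no_loops'[OF u(1)] by metis
qed

lemma finite_parts: "finite A" "finite B" "finite S"
  using pair_finite_verts unfolding partition(1)[symmetric] by simp_all

lemma two_le_card_A: "2 \<le> card A"
  by (rule two_le_card_if_partner[OF finite_parts(1) nonempty(1)]) (use neighbour_in_A in blast)

lemma two_le_card_B: "2 \<le> card B"
  by (rule separated_graph.two_le_card_A[OF separated_graph_swap])

lemma card_verts: "card (pverts G) = card A + card B + card S"
proof -
  have "card (A \<union> B \<union> S) = card (A \<union> B) + card S"
    using finite_parts partition by (intro card_Un_disjoint) auto
  then show ?thesis using finite_parts partition by (simp add: card_Un_disjoint)
qed

definition cross_pairs :: "'a set set" where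
  "cross_pairs = (\<lambda>(a, b). {a, b}) ` (A \<times> B)"

lemma cross_pairs_iff:
  "{p, q} \<in> cross_pairs \<longleftrightarrow> p \<in> A \<and> q \<in> B \<or> p \<in> B \<and> q \<in> A"
  by (auto simp: cross_pairs_def image_iff doubleton_eq_iff)

text \<open>As \<open>A\<close> and \<open>B\<close> are disjoint, an unordered cross pair
  determines which of its elements lies in \<open>A\<close>.\<close>

lemma card_cross_pairs: "card cross_pairs = card A * card B"
proof -
  have "inj_on (\<lambda>(a, b). {a, b}) (A \<times> B)"
    using partition(2) by (auto simp: inj_on_def doubleton_eq_iff)
  then show ?thesis by (simp add: cross_pairs_def card_image card_cartesian_product)
qed

lemma cross_pairs_missing: "cross_pairs \<subseteq> missing_edges"
proof
  fix X assume "X \<in> cross_pairs"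
  then obtain a b where ab: "a \<in> A" "b \<in> B" and X: "X = {a, b}"
    by (auto simp: cross_pairs_def)
  have "a \<in> pverts G" "b \<in> pverts G" "a \<noteq> b" using ab partition(1,2) by auto
  then show "X \<in> missing_edges" unfolding X using in_missing_edges_iff no_cross_arcs[OF ab] by blast
qed

text \<open>Its cardinality is the \<open>r\<close> of \<open>separation_arithmetic\<close>.\<close>

definition extra :: "'a set set" where
  "extra = missing_edges - cross_pairs"

lemma finite_extra: "finite extra"
  by (simp add: extra_def finite_missing_edges)

lemma card_S_extra: "card S = min_degree G" "card extra \<le> 1"
proof -
  have "card missing_edges = card A * card B + card extra"
    unfolding extra_def using cross_pairs_missing card_cross_pairs
    by (metis card_Diff_subset card_mono finite_missing_edges finite_subset le_add_diff_inverse)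
  then have "card (edge_set G) + (card A * card B + card extra) = card (pverts G) choose 2"
    using card_edge_set_plus_missing by simp
  from separation_arithmetic[OF two_le_card_A two_le_card_B card_S_le card_verts edges_ge this]
  show "card S = min_degree G" "card extra \<le> 1" by blast+
qed

lemma in_extra_iff:
  assumes "p \<in> pverts G" "q \<in> pverts G" "p \<noteq> q"
  shows "{p, q} \<in> extra \<longleftrightarrow>
    (p, q) \<notin> parcs G \<and> \<not> (p \<in> A \<and> q \<in> B) \<and> \<not> (p \<in> B \<and> q \<in> A)"
  unfolding extra_def Diff_iff cross_pairs_iff in_missing_edges_iff[OF assms] by blast

text \<open>\<open>U\<close> consists of \<open>v\<close>, its neighbours and its non-neighbours in
  \<open>U\<close>. The map taking \<open>u\<close> to \<open>{v, u}\<close> injects the latter into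
  \<open>extra\<close>, so there is at most one. The lemma serves for \<open>U = pverts G\<close>
  when \<open>v\<close> is in \<open>S\<close>, and for \<open>U = A \<union> S\<close> when
  \<open>v\<close> is in \<open>A\<close>.\<close>

lemma card_non_neighbours:
  assumes "v \<in> U" "U \<subseteq> pverts G"
    and "\<And>u. u \<in> U \<Longrightarrow> \<not> (v \<in> A \<and> u \<in> B) \<and> \<not> (v \<in> B \<and> u \<in> A)"
    and "{u. (v, u) \<in> parcs G} \<subseteq> U"
  shows "card U \<le> card {u. (v, u) \<in> parcs G} + 2"
    and "card {u \<in> U. u \<noteq> v \<and> (v, u) \<notin> parcs G} + 1 + card {u. (v, u) \<in> parcs G} = card U"
proof -
  let ?N = "{u. (v, u) \<in> parcs G}"
  let ?M = "{u \<in> U. u \<noteq> v \<and> (v, u) \<notin> parcs G}"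
  have fin: "finite U" using assms(2) pair_finite_verts by (rule finite_subset)
  have "U = insert v (?M \<union> ?N)" using assms(1,4) by auto
  moreover have "card (insert v (?M \<union> ?N)) = Suc (card ?M + card ?N)"
    using fin no_loops' finite_neighbours
    by (subst card_insert_disjoint) (auto intro!: card_Un_disjoint)
  ultimately show card_U: "card ?M + 1 + card ?N = card U" by simp
  have "(\<lambda>u. {v, u}) ` ?M \<subseteq> extra"
    using assms(1-3) by (auto simp: in_extra_iff subset_iff)
  moreover have "inj_on (\<lambda>u. {v, u}) ?M" by (auto simp: inj_on_def doubleton_eq_iff)
  ultimately have "card ?M \<le> card extra"
    by (intro card_inj_on_le[OF _ _ finite_extra])
  then show "card U \<le> card ?N + 2" using card_U card_S_extra(2) by simp
qed

section \<open>Vertices of minimum degree\<close>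

text \<open>A vertex of \<open>S\<close> lies in no cross pair, so the bound with
  \<open>U = pverts G\<close> gives order at most \<delta> + 2. But the order is at least \<delta> +
  4, as both sides have two vertices or more.\<close>

lemma min_degree_vertex_not_in_S:
  assumes "v \<in> pverts G" "card {u. (v, u) \<in> parcs G} = min_degree G"
  shows "v \<in> A \<union> B"
proof (rule ccontr)
  assume v: "v \<notin> A \<union> B"
  have "{u. (v, u) \<in> parcs G} \<subseteq> pverts G" using in_arcsD2 by blast
  then have "card (pverts G) \<le> min_degree G + 2"
    using card_non_neighbours(1)[OF assms(1) order_refl] v assms(2) by simp
  then show False using card_verts two_le_card_A two_le_card_B card_S_extra(1) by simp
qed

text \<open>\<open>A \<union> S\<close> has \<open>card A\<close> + \<delta> elements and contains
  all \<delta> neighbours of \<open>v\<close>, with at most one non-neighbour besides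
  \<open>v\<close> itself. So \<open>card A = 2\<close>, there is exactly one such non-neighbour
  \<open>w\<close>, and \<open>{v, w}\<close> exhausts \<open>extra\<close>.\<close>

lemma min_degree_vertex_structure:
  assumes "v \<in> A" "card {u. (v, u) \<in> parcs G} = min_degree G"
  shows "card A = 2"
    and "\<exists>w \<in> S. \<forall>p \<in> pverts G. \<forall>q \<in> pverts G. (p, q) \<in> parcs G \<longleftrightarrow>
      p \<noteq> q \<and> \<not> (p \<in> A \<and> q \<in> B) \<and> \<not> (p \<in> B \<and> q \<in> A) \<and> {p, q} \<noteq> {v, w}"
proof -
  let ?N = "{u. (v, u) \<in> parcs G}"
  have sub: "A \<union> S \<subseteq> pverts G" using partition(1) by blast
  have nbs: "?N \<subseteq> A \<union> S"
  proof
    fix u assume "u \<in> ?N"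
    then have u: "(v, u) \<in> parcs G" by simp
    show "u \<in> A \<union> S"
      using in_arcsD2[OF u] no_cross_arcs[OF assms(1), of u] u partition(1) by blast
  qed
  have "\<not> (v \<in> A \<and> u \<in> B) \<and> \<not> (v \<in> B \<and> u \<in> A)" if "u \<in> A \<union> S" for u
    using that assms(1) partition by blast
  note bound = card_non_neighbours[OF UnI1[OF assms(1)] sub this nbs]
  have card_AS: "card (A \<union> S) = card A + min_degree G"
    using finite_parts partition(3) card_S_extra(1) by (simp add: card_Un_disjoint)
  then show card_A: "card A = 2"
    using bound(1) assms(2) two_le_card_A by simp
  have "card {u \<in> A \<union> S. u \<noteq> v \<and> (v, u) \<notin> parcs G} = 1"
    using bound(2) card_AS card_A assms(2) by linarith
  then obtain w where "{u \<in> A \<union> S. u \<noteq> v \<and> (v, u) \<notin> parcs G} = {w}"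
    by (rule card_1_singletonE)
  then have w: "w \<in> A \<union> S" "w \<noteq> v" "(v, w) \<notin> parcs G" by blast+
  have "w \<in> S"
  proof (rule ccontr)
    assume "w \<notin> S"
    then have "w \<in> A" using w(1) by blast
    \<comment> \<open>If \<open>w\<close> were in \<open>A\<close>, then \<open>v\<close>,
      \<open>w\<close> and a neighbour of \<open>v\<close> in \<open>A\<close> would be three
      distinct elements of a two-element set.\<close>
    obtain u where u: "u \<in> A" "u \<noteq> v" "(v, u) \<in> parcs G"
      using neighbour_in_A[OF assms(1)] by blast
    have "card {u, v, w} \<le> card A"
      using finite_parts(1) u(1) assms(1) \<open>w \<in> A\<close> by (intro card_mono) auto
    moreover have "u \<noteq> w" using u(3) w(3) by blast
    then have "card {u, v, w} = 3" using u(2) w(2) by simp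
    ultimately show False using card_A by simp
  qed
  have mem: "{v, w} \<in> extra"
    using in_extra_iff[of v w] w assms(1) \<open>w \<in> S\<close> partition by blast
  have "{{v, w}} = extra"
    using mem card_S_extra(2) by (intro card_seteq finite_extra) simp_all
  then have extra_eq: "X \<in> extra \<longleftrightarrow> X = {v, w}" for X by blast
  have "(p, q) \<in> parcs G \<longleftrightarrow>
      p \<noteq> q \<and> \<not> (p \<in> A \<and> q \<in> B) \<and> \<not> (p \<in> B \<and> q \<in> A) \<and> {p, q} \<noteq> {v, w}"
    if pq: "p \<in> pverts G" "q \<in> pverts G" for p q
  proof (cases "p = q")
    case True
    then show ?thesis using no_loops' by blast
  next
    case False
    show ?thesis
      using in_extra_iff[OF pq False, unfolded extra_eq] False
        no_cross_arcs[of p q] no_cross_arcs'[of q p] by argo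
  qed
  then show "\<exists>w \<in> S. \<forall>p \<in> pverts G. \<forall>q \<in> pverts G. (p, q) \<in> parcs G \<longleftrightarrow>
      p \<noteq> q \<and> \<not> (p \<in> A \<and> q \<in> B) \<and> \<not> (p \<in> B \<and> q \<in> A) \<and> {p, q} \<noteq> {v, w}"
    by (intro bexI[OF _ \<open>w \<in> S\<close>] ballI)
qed

end

section \<open>The extremal graph and isomorphisms onto it\<close>

text \<open>Arcs are pairs of vertices, so the vertex map \<open>f\<close> induces the arc map
  \<open>map_prod f f\<close>. It is injective because both ends of every arc lie in
  \<open>pverts G\<close>.\<close>

lemma digraph_iso_with_projI:
  assumes "wf_digraph (with_proj G)" "bij_betw f (pverts G) (pverts H)"
    and "parcs H = map_prod f f ` parcs G"
  shows "digraph_iso (with_proj G) (with_proj H)"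
proof -
  interpret G: wf_digraph "with_proj G" by fact
  let ?h = "\<lparr>iso_verts = f, iso_arcs = map_prod f f, iso_head = snd, iso_tail = fst\<rparr>"
  have inj: "inj_on f (pverts G)" using assms(2) by (simp add: bij_betw_def)
  have sub: "parcs G \<subseteq> pverts G \<times> pverts G"
    using G.head_in_verts G.tail_in_verts by fastforce
  have "inj_on (map_prod f f) (parcs G)"
    using inj_on_subset[OF map_prod_inj_on[OF inj inj] sub] .
  then have "G.digraph_isomorphism ?h"
    using inj assms(1) by (simp add: G.digraph_isomorphism_def)
  moreover have "with_proj H = app_iso ?h (with_proj G)"
    using assms(2,3) by (simp add: app_iso_def with_proj_def bij_betw_def)
  ultimately show ?thesis unfolding digraph_iso_def by blast
qed

definition extremal_join :: "nat \<Rightarrow> nat \<Rightarrow> nat \<Rightarrow> (nat + nat + nat) pair_pre_digraph" where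
  "extremal_join s a b =
     graph_join (complete_graph s) (disjoint_union (complete_graph a) (complete_graph b))"

lemma pverts_extremal_join:
  "pverts (extremal_join s a b) = Inl ` {..<s} \<union> Inr ` Inl ` {..<a} \<union> Inr ` Inr ` {..<b}"
  by (auto simp: extremal_join_def graph_join_def disjoint_union_def complete_graph_def)

text \<open>Describing adjacency by its exceptions gives the same shape as
  \<open>min_degree_vertex_structure\<close> has for \<open>G\<close>, with
  \<open>Inr (Inl _)\<close> for \<open>A\<close> and \<open>Inr (Inr _)\<close> for
  \<open>B\<close>.\<close>

lemma parcs_extremal_join:
  "parcs (extremal_join s a b) = {(x, y). x \<in> pverts (extremal_join s a b) \<and>
     y \<in> pverts (extremal_join s a b) \<and> x \<noteq> y \<and>
     \<not> (x \<in> range (Inr \<circ> Inl) \<and> y \<in> range (Inr \<circ> Inr)) \<and>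
     \<not> (x \<in> range (Inr \<circ> Inr) \<and> y \<in> range (Inr \<circ> Inl))}"
  (is "?L = ?R")
proof -
  have "(x, y) \<in> ?L \<longleftrightarrow> (x, y) \<in> ?R" for x y
    \<comment> \<open>For \<open>x\<close> of the form \<open>Inl _\<close> the value
      \<open>projr x\<close> is unspecified; splitting on it is then redundant but harmless.\<close>
    by (cases x; cases "projr x"; cases y; cases "projr y")
      (auto simp: extremal_join_def graph_join_def disjoint_union_def complete_graph_def)
  then show ?thesis by auto
qed

lemma out_degree_extremal_join_Inl:
  assumes "j < s"
  shows "out_degree (with_proj (extremal_join s a b)) (Inl j) = s + a + b - 1"
proof -
  have "{u. (Inl j, u) \<in> parcs (extremal_join s a b)} = pverts (extremal_join s a b) - {Inl j}"
    using assms unfolding parcs_extremal_join by (auto simp: pverts_extremal_join)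
  moreover have "card (pverts (extremal_join s a b)) = s + a + b"
    unfolding pverts_extremal_join
    by (subst card_Un_disjoint, simp, simp, force)+ (simp add: card_image inj_on_def image_image)
  moreover have "Inl j \<in> pverts (extremal_join s a b)"
    using assms by (simp add: pverts_extremal_join)
  ultimately show ?thesis by (simp add: out_degree_with_proj)
qed

text \<open>For \<open>s\<close> = \<delta> and \<open>a = 2\<close> this is \<delta> + 1, the
  degree required of the end \<open>x\<close> of the deleted edge.\<close>

lemma out_degree_extremal_join_Inr_Inl:
  assumes "i < a"
  shows "out_degree (with_proj (extremal_join s a b)) (Inr (Inl i)) = s + a - 1"
proof -
  have "{u. (Inr (Inl i), u) \<in> parcs (extremal_join s a b)} =
      Inl ` {..<s} \<union> Inr ` Inl ` {..<a} - {Inr (Inl i)}"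
    using assms unfolding parcs_extremal_join by (auto simp: pverts_extremal_join)
  moreover have "card (Inl ` {..<s} \<union> Inr ` Inl ` {..<a} :: (nat + nat + nat) set) = s + a"
    by (subst card_Un_disjoint) (auto simp: card_image inj_on_def image_image)
  ultimately show ?thesis using assms by (simp add: out_degree_with_proj)
qed

text \<open>Enumerations of \<open>S\<close>, \<open>A\<close> and \<open>B\<close> combine to a
  bijection \<open>f\<close> of the vertices. Both graphs lack exactly the pairs between the two
  sides and one further pair, which is \<open>{v, w}\<close> in \<open>G\<close> and
  \<open>{f v, f w}\<close> in the image.\<close>

lemma digraph_iso_extremal_join:
  assumes "pair_graph G"
    and part: "A \<union> B \<union> S = pverts G" "A \<inter> B = {}" "A \<inter> S = {}" "B \<inter> S = {}"
    and "v \<in> A" "w \<in> S"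
    and adj: "\<And>p q. p \<in> pverts G \<Longrightarrow> q \<in> pverts G \<Longrightarrow> (p, q) \<in> parcs G \<longleftrightarrow>
      p \<noteq> q \<and> \<not> (p \<in> A \<and> q \<in> B) \<and> \<not> (p \<in> B \<and> q \<in> A) \<and> {p, q} \<noteq> {v, w}"
  shows "\<exists>i j. i < card A \<and> j < card S \<and>
    digraph_iso (with_proj G)
      (with_proj (delete_edge (extremal_join (card S) (card A) (card B)) (Inr (Inl i)) (Inl j)))"
proof -
  interpret pair_graph G by fact
  have fin: "finite A" "finite B" "finite S"
    using pair_finite_verts unfolding part(1)[symmetric] by simp_all
  obtain g h l where g: "bij_betw g S {..<card S}" and h: "bij_betw h A {..<card A}"
      and l: "bij_betw l B {..<card B}"
    using fin by (metis ex_bij_betw_finite_nat atLeast0LessThan)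
  \<comment> \<open>On \<open>pverts G\<close> the last branch is reached exactly by the vertices of
    \<open>B\<close>.\<close>
  define f where "f p = (if p \<in> S then Inl (g p) else if p \<in> A then Inr (Inl (h p))
    else Inr (Inr (l p)))" for p
  let ?J = "extremal_join (card S) (card A) (card B)"
  have f_eq: "f p = Inl (g p)" if "p \<in> S" for p using that by (simp add: f_def)
  have f_eqA: "f p = Inr (Inl (h p))" if "p \<in> A" for p using that part by (auto simp: f_def)
  have f_eqB: "f p = Inr (Inr (l p))" if "p \<in> B" for p using that part by (auto simp: f_def)
  have "bij_betw f S (Inl ` {..<card S})"
    using g by (auto simp: bij_betw_def inj_on_def f_eq image_iff)
  moreover have "bij_betw f A (Inr ` Inl ` {..<card A})"
    using h by (auto simp: bij_betw_def inj_on_def f_eqA image_iff)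
  moreover have "bij_betw f B (Inr ` Inr ` {..<card B})"
    using l by (auto simp: bij_betw_def inj_on_def f_eqB image_iff)
  ultimately have "bij_betw f (S \<union> A \<union> B) (pverts ?J)"
    unfolding pverts_extremal_join by (intro bij_betw_combine) auto
  then have bij: "bij_betw f (pverts G) (pverts ?J)"
    using part(1) by (simp add: Un_ac)
  then have inj: "f p = f q \<longleftrightarrow> p = q" if "p \<in> pverts G" "q \<in> pverts G" for p q
    using that by (auto simp: bij_betw_def inj_on_def)
  have range_A: "f p \<in> range (Inr \<circ> Inl) \<longleftrightarrow> p \<in> A"
    and range_B: "f p \<in> range (Inr \<circ> Inr) \<longleftrightarrow> p \<in> B" if "p \<in> pverts G" for p
    using that part by (auto simp: f_def)
  have vw: "v \<in> pverts G" "w \<in> pverts G" using \<open>v \<in> A\<close> \<open>w \<in> S\<close> part(1) by auto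
  let ?D = "delete_edge ?J (f v) (f w)"
  \<comment> \<open>\<open>range_A\<close>, \<open>range_B\<close> and \<open>inj\<close> turn each
    exception to adjacency in the join into the corresponding one in \<open>adj\<close>.\<close>
  have arc_iff: "(f p, f q) \<in> parcs ?D \<longleftrightarrow> (p, q) \<in> parcs G"
    if pq: "p \<in> pverts G" "q \<in> pverts G" for p q
  proof -
    have "f p \<in> pverts ?J" "f q \<in> pverts ?J" using bij pq by (auto simp: bij_betw_def)
    then show ?thesis
      using adj[OF pq] vw pq
      by (auto simp: delete_edge_def parcs_extremal_join range_A range_B inj doubleton_eq_iff
          simp del: comp_apply)
  qed
  have "parcs ?D = map_prod f f ` parcs G"
  proof (intro equalityI subrelI)
    fix x y assume xy: "(x, y) \<in> parcs ?D"
    then have "x \<in> f ` pverts G" "y \<in> f ` pverts G"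
      using bij by (auto simp: delete_edge_def parcs_extremal_join bij_betw_def)
    then obtain p q where "p \<in> pverts G" "q \<in> pverts G" "x = f p" "y = f q" by blast
    then show "(x, y) \<in> map_prod f f ` parcs G" using xy arc_iff by auto
  next
    fix x y assume "(x, y) \<in> map_prod f f ` parcs G"
    then show "(x, y) \<in> parcs ?D" using arc_iff in_arcsD1 in_arcsD2 by auto
  qed
  then have "digraph_iso (with_proj G) (with_proj ?D)"
    using bij by (intro digraph_iso_with_projI[where f = f] wf_digraph_axioms)
      (auto simp: delete_edge_def)
  moreover have "h v < card A" "g w < card S"
    using h g \<open>v \<in> A\<close> \<open>w \<in> S\<close> by (auto simp: bij_betw_def)
  ultimately show ?thesis using f_eq[OF \<open>w \<in> S\<close>] f_eqA[OF \<open>v \<in> A\<close>] by auto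
qed

lemma (in separated_graph) iso_extremal_join_minus_edge:
  assumes "v \<in> A" "card {u. (v, u) \<in> parcs G} = min_degree G"
  shows "\<exists>x y. (x, y) \<in> parcs (extremal_join (card S) 2 (card B)) \<and>
    out_degree (with_proj (extremal_join (card S) 2 (card B))) x = card S + 1 \<and>
    out_degree (with_proj (extremal_join (card S) 2 (card B))) y = card (pverts G) - 1 \<and>
    digraph_iso (with_proj G) (with_proj (delete_edge (extremal_join (card S) 2 (card B)) x y))"
proof -
  note card_A = min_degree_vertex_structure(1)[OF assms]
  obtain w where w: "w \<in> S" "\<forall>p \<in> pverts G. \<forall>q \<in> pverts G. (p, q) \<in> parcs G \<longleftrightarrow>
      p \<noteq> q \<and> \<not> (p \<in> A \<and> q \<in> B) \<and> \<not> (p \<in> B \<and> q \<in> A) \<and> {p, q} \<noteq> {v, w}"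
    using min_degree_vertex_structure(2)[OF assms] by blast
  obtain i j where ij: "i < 2" "j < card S"
      "digraph_iso (with_proj G)
        (with_proj (delete_edge (extremal_join (card S) 2 (card B)) (Inr (Inl i)) (Inl j)))"
    using digraph_iso_extremal_join[OF pair_graph partition assms(1) w(1)] w(2) card_A by metis
  show ?thesis
  proof (intro exI conjI)
    show "(Inr (Inl i), Inl j) \<in> parcs (extremal_join (card S) 2 (card B))"
      using ij(1,2) by (auto simp: parcs_extremal_join pverts_extremal_join)
  qed (use ij card_verts card_A in
      \<open>simp_all add: out_degree_extremal_join_Inl out_degree_extremal_join_Inr_Inl\<close>)
qed

section \<open>From a violating minimum cut to the extremal graph\<close>

text \<open>A vertex isolated by \<open>S\<close> has all its neighbours in \<open>S\<close>, and
  \<open>card S\<close> is at most \<delta>. Its degree is therefore exactly \<delta>, which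
  \<open>bad\<close> forbids, so no vertex at all is isolated.\<close>

lemma (in pair_graph) separated_graph_if_no_isolated_vertex:
  assumes cut: "min_vertex_cut G S"
    and bad: "\<not> (\<exists>v. {v} \<in> pre_digraph.sccs_verts (delete_verts G S) \<and>
             out_degree (with_proj G) v = min_degree G)"
    and edges: "((card (pverts G) - 2) choose 2) + 2 * min_degree G \<le> card (edge_set G)"
  obtains A B where "separated_graph G A B S"
proof -
  have S: "S \<subseteq> pverts G" and "card S = vertex_connectivity G"
    using cut by (auto simp: min_vertex_cut_def vertex_cut_iff_separation)
  obtain A B where AB: "A \<noteq> {}" "B \<noteq> {}" "A \<inter> B = {}" "A \<union> B = pverts G - S"
      "\<forall>a \<in> A. \<forall>b \<in> B. (a, b) \<notin> parcs G"
    using cut unfolding min_vertex_cut_def vertex_cut_iff_separation by (elim conjE exE) (rule that)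
  have "pverts G \<noteq> {}" using AB by blast
  then have card_S: "card S \<le> min_degree G"
    using vertex_connectivity_le_min_degree \<open>card S = vertex_connectivity G\<close> by simp
  have finS: "finite S" using S pair_finite_verts by (rule finite_subset)
  have neighbour: "\<exists>u. (v, u) \<in> parcs G \<and> u \<notin> S" if v: "v \<in> pverts G - S" for v
  proof (rule ccontr)
    assume no: "\<nexists>u. (v, u) \<in> parcs G \<and> u \<notin> S"
    then have "card {u. (v, u) \<in> parcs G} \<le> card S" using finS by (intro card_mono) auto
    then have "out_degree (with_proj G) v = min_degree G"
      using min_degree_le[of v] card_S v by (simp add: out_degree_with_proj)
    then show False using bad isolated_in_sccs_verts[OF v] no by blast
  qed
  have "separated_graph G A B S"
    using AB S neighbour card_S edges by unfold_locales auto
  then show ?thesis by (rule that)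
qed

theorem theorem4p1:
  fixes G :: "'a pair_pre_digraph" and n m \<delta> :: nat
  assumes "pair_graph G"
    and "connected (with_proj G)"
    and "n = card (pverts G)"
    and "m = card (edge_set G)"
    and "\<delta> = min_degree G"
    and "n \<ge> 5"
    and "m \<ge> ((n - 2) choose 2) + 2 * \<delta>"
  shows "super_connected G \<or>
    (\<delta> + 2 \<le> n \<and>
     (let H = graph_join (complete_graph \<delta>)
                (disjoint_union (complete_graph 2) (complete_graph (n - \<delta> - 2)))
      in \<exists>x y. (x, y) \<in> parcs H \<and>
           out_degree (with_proj H) x = \<delta> + 1 \<and> out_degree (with_proj H) y = n - 1 \<and>
           digraph_iso (with_proj G) (with_proj (delete_edge H x y))))"
proof (subst disj_imp, rule impI)
  interpret pair_graph G by fact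
  assume "\<not> super_connected G"
  then obtain S where "min_vertex_cut G S"
      and "\<not> (\<exists>v. {v} \<in> pre_digraph.sccs_verts (delete_verts G S) \<and>
             out_degree (with_proj G) v = min_degree G)"
    unfolding super_connected_def by blast
  then obtain A B where sep: "separated_graph G A B S"
    using separated_graph_if_no_isolated_vertex assms(3-5,7) by metis
  have "pverts G \<noteq> {}" using assms(3,6) by auto
  then obtain v where v: "v \<in> pverts G" "card {u. (v, u) \<in> parcs G} = min_degree G"
    by (rule min_degree_witness)
  \<comment> \<open>The vertex \<open>v\<close> lies in one of the two sides; exchanging them if
    necessary puts it into \<open>A\<close>.\<close>
  obtain A B where sep: "separated_graph G A B S" and "v \<in> A"
    using separated_graph.min_degree_vertex_not_in_S[OF sep v] sep
      separated_graph.separated_graph_swap[OF sep] by blast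
  interpret separated_graph G A B S by fact
  have "card A = 2" using min_degree_vertex_structure(1) \<open>v \<in> A\<close> v(2) by blast
  then have "n = \<delta> + 2 + card B" and S: "card S = \<delta>"
    using card_verts card_S_extra(1) assms(3,5) by simp_all
  \<comment> \<open>The inequality ensures that the subtraction of natural numbers in
    \<open>n - \<delta> - 2\<close> is not truncated.\<close>
  then have "\<delta> + 2 \<le> n" and B: "n - \<delta> - 2 = card B" by simp_all
  then show "\<delta> + 2 \<le> n \<and>
     (let H = graph_join (complete_graph \<delta>)
                (disjoint_union (complete_graph 2) (complete_graph (n - \<delta> - 2)))
      in \<exists>x y. (x, y) \<in> parcs H \<and>
           out_degree (with_proj H) x = \<delta> + 1 \<and> out_degree (with_proj H) y = n - 1 \<and>
           digraph_iso (with_proj G) (with_proj (delete_edge H x y)))"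
    using iso_extremal_join_minus_edge[OF \<open>v \<in> A\<close> v(2)]
    unfolding Let_def extremal_join_def B S assms(3)[symmetric] by blast
qed

end
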